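(* Let $B=F(b_1,\ldots,b_n)$ be a Ferrers board with $0\le b_1\le\cdots\le b_n$ and $b_n>0$, and let $B^-=F(b_1,\ldots,b_{n-1})$. Then for all $1\le k\le n$, $$\mathbf{FT}_k(B,q)=q^{F_{b_n}}\mathbf{FT}_k(B^-,q)+[F_{b_n}]_q\,\mathbf{FT}_{k-1}(B^-,q)$$ and $$\overline{\mathbf{FT}}_k(B,q)=\overline{\mathbf{FT}}_k(B^-,q)+[F_{b_n}]_q\,\overline{\mathbf{FT}}_{k-1}(B^-,q).$$
   Context: Fibonacci numbers: $F_0=0$, $F_1=1$, $F_m=F_{m-1}+F_{m-2}$. For an integer $m$, $[m]_q=\frac{1-q^m}{1-q}$. For $m\ge1$, $\mathcal{F}_m$ is the set of tilings of a column of height $m$ (levels $1,\dots,m$ from the bottom) by tiles of heights 1 and 2 whose bottom-most tile has height 1; $\mathcal{F}_0=\emptyset$. For $T\in\mathcal{F}_m$, $\mathrm{rank}_m(T)=\sum F_{i-1}$, the sum over all $i$ such that $T$ has a tile of height 2 occupying levels $i-1$ and $i$. A Ferrers board $F(b_1,\dots,b_n)$ has columns $1,\dots,n$ of heights $b_1\le\cdots\le b_n$. For $0\le k\le n$, $\mathcal{FT}_k(B)$ is the set of Fibonacci file placements: a set $I$ of $k$ columns together with, for each $i\in I$, a tiling $T_i\in\mathcal{F}_{b_i}$ (for $k<0$ or $k>n$ the set is empty; for $k=0$ it contains only the empty placement). For such $P$, $w_{B,q}(P)=q^{\sum_{i\in I}\mathrm{rank}_{b_i}(T_i)+\sum_{j\notin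 I}F_{b_j}}$ and $\overline{w}_{B,q}(P)=q^{\sum_{i\in I}\mathrm{rank}_{b_i}(T_i)}$. Then $\mathbf{FT}_k(B,q)=\sum_{P\in\mathcal{FT}_k(B)}w_{B,q}(P)$ and $\overline{\mathbf{FT}}_k(B,q)=\sum_{P\in\mathcal{FT}_k(B)}\overline{w}_{B,q}(P)$. *)

theory Defs
  imports Complex_Main "HOL-Number_Theory.Fib" "HOL-Library.FuncSet"
begin

definition qint :: "'a::field \<Rightarrow> int \<Rightarrow> 'a" where
  "qint q m = (1 - q powi m) / (1 - q)"

text \<open>A tiling of a column is the list of its tile heights, read from the bottom upwards.
  For \<open>m = 0\<close> the set is empty, since the only list with sum 0 has no bottom tile.\<close>

definition fib_tilings :: "nat \<Rightarrow> nat list set" where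
  "fib_tilings m = {T. set T \<subseteq> {1, 2} \<and> sum_list T = m \<and> T \<noteq> [] \<and> hd T = 1}"

text \<open>The tile with list index \<open>j\<close> has its top at level \<open>sum_list (take (Suc j) T)\<close>, so
  a tile of height 2 occupies that level \<open>i\<close> and the level \<open>i - 1\<close>.\<close>

definition domino_tops :: "nat list \<Rightarrow> nat set" where
  "domino_tops T = {i. \<exists>j < length T. T ! j = 2 \<and> sum_list (take (Suc j) T) = i}"

definition tiling_rank :: "nat list \<Rightarrow> nat" where
  "tiling_rank T = (\<Sum>i\<in>domino_tops T. fib (i - 1))"

text \<open>The board \<open>F(b\<^sub>1, \<dots>, b\<^sub>n)\<close> is the list \<open>[b\<^sub>1, \<dots>, b\<^sub>n]\<close>, so column \<open>i\<close> of the board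
  has list index \<open>i - 1\<close>. A placement is a pair of a column set and an (extensional) family
  of tilings indexed by it.\<close>

definition fib_file_placements :: "nat \<Rightarrow> nat list \<Rightarrow> (nat set \<times> (nat \<Rightarrow> nat list)) set" where
  "fib_file_placements k B =
     (SIGMA I : {I. I \<subseteq> {..<length B} \<and> card I = k}. \<Pi>\<^sub>E i\<in>I. fib_tilings (B ! i))"

definition placement_weight ::
  "nat list \<Rightarrow> 'a::comm_semiring_1 \<Rightarrow> nat set \<times> (nat \<Rightarrow> nat list) \<Rightarrow> 'a" where
  "placement_weight B q P =
     (case P of (I, T) \<Rightarrow>
        q ^ ((\<Sum>i\<in>I. tiling_rank (T i)) + (\<Sum>j\<in>{..<length B} - I. fib (B ! j))))"

definition placement_weight_bar ::
  "'a::comm_semiring_1 \<Rightarrow> nat set \<times> (nat \<Rightarrow> nat list) \<Rightarrow> 'a" where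
  "placement_weight_bar q P = (case P of (I, T) \<Rightarrow> q ^ (\<Sum>i\<in>I. tiling_rank (T i)))"

definition FT :: "nat \<Rightarrow> nat list \<Rightarrow> 'a::comm_semiring_1 \<Rightarrow> 'a" where
  "FT k B q = (\<Sum>P\<in>fib_file_placements k B. placement_weight B q P)"

definition FT_bar :: "nat \<Rightarrow> nat list \<Rightarrow> 'a::comm_semiring_1 \<Rightarrow> 'a" where
  "FT_bar k B q = (\<Sum>P\<in>fib_file_placements k B. placement_weight_bar q P)"

lemma finite_fib_tilings: "finite (fib_tilings m)"
proof -
  have "length T \<le> sum_list T" if "set T \<subseteq> {1, 2}" for T :: "nat list"
    using that by (induction T) auto
  then have "fib_tilings m \<subseteq> {T. set T \<subseteq> {1, 2} \<and> length T \<le> m}"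
    by (auto simp: fib_tilings_def)
  then show ?thesis
    by (rule finite_subset) (simp add: finite_lists_length_le)
qed

lemma finite_fib_file_placements: "finite (fib_file_placements k B)"
proof -
  have "finite {I. I \<subseteq> {..<length B} \<and> card I = k}"
    by (rule finite_subset[of _ "Pow {..<length B}"]) auto
  then show ?thesis
    unfolding fib_file_placements_def
    by (rule finite_SigmaI) (auto intro!: finite_PiE finite_fib_tilings intro: finite_subset)
qed

end

theory Submission imports Defs begin

text \<open>Removing the top tile splits the tilings of height \<open>m + 2\<close> into those of height \<open>m + 1\<close>,
  with unchanged rank, and those of height \<open>m\<close>, with rank raised by \<open>F\<^bsub>m+1\<^esub>\<close>. Hence the rank is
  a bijection onto \<open>{0, \<dots>, F\<^sub>m - 1}\<close>, and its generating function is \<open>[F\<^sub>m]\<^sub>q\<close>. Summing out the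
  tilings turns both placement sums into sums over \<open>k\<close>-subsets of the columns of products
  of column weights; splitting by whether the last column is chosen gives the recurrences.\<close>

text \<open>Prefix sums at the old indices do not change. The only new index is the last one, and
  its prefix is the whole list.\<close>

lemma domino_tops_snoc:
  "domino_tops (T @ [a]) =
     (if a = 2 then insert (sum_list T + 2) (domino_tops T) else domino_tops T)"
proof -
  have "i \<in> domino_tops (T @ [a]) \<longleftrightarrow> (a = 2 \<and> i = sum_list T + 2) \<or> i \<in> domino_tops T" for i
    unfolding domino_tops_def
    by (simp add: Ex_less_Suc nth_append cong: conj_cong) metis
  then show ?thesis
    by (simp add: set_eq_iff)
qed

lemma domino_tops_le:
  assumes "i \<in> domino_tops T"
  shows "i \<le> sum_list T"
proof -
  from assms obtain j where "sum_list (take (Suc j) T) = i"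
    by (auto simp: domino_tops_def)
  moreover have "sum_list T = sum_list (take (Suc j) T) + sum_list (drop (Suc j) T)"
    by (metis append_take_drop_id sum_list_append)
  ultimately show ?thesis by simp
qed

lemma finite_domino_tops: "finite (domino_tops T)"
  by (rule finite_subset[of _ "{..sum_list T}"]) (auto dest: domino_tops_le)

text \<open>A domino placed on top ends at level \<open>sum_list T + 2\<close>. By
  \<open>domino_tops_le\<close> this level is above all earlier tops, so the rank gains exactly one
  new summand.\<close>

lemma tiling_rank_snoc:
  "tiling_rank (T @ [a]) = tiling_rank T + (if a = 2 then fib (Suc (sum_list T)) else 0)"
proof -
  have "sum_list T + 2 \<notin> domino_tops T"
    using domino_tops_le by fastforce
  then show ?thesis
    by (simp add: tiling_rank_def domino_tops_snoc finite_domino_tops)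
qed

lemma fib_tilings_0: "fib_tilings 0 = {}"
  by (auto simp: fib_tilings_def neq_Nil_conv)

lemma fib_tilings_1: "fib_tilings (Suc 0) = {[1]}"
proof -
  have "T = [1]" if "T \<in> fib_tilings (Suc 0)" for T
  proof -
    from that obtain T' where T': "T = 1 # T'" "set T' \<subseteq> {1, 2}" "sum_list T' = 0"
      by (cases T) (auto simp: fib_tilings_def)
    then have "T' = []" by (cases T') auto
    with T' show ?thesis by simp
  qed
  then show ?thesis by (auto simp: fib_tilings_def)
qed

lemma fib_tilings_Suc_Suc:
  "fib_tilings (Suc (Suc m)) =
     (\<lambda>T. T @ [1]) ` fib_tilings (Suc m) \<union> (\<lambda>T. T @ [2]) ` fib_tilings m"
proof (intro equalityI subsetI)
  fix T assume T: "T \<in> fib_tilings (Suc (Suc m))"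
  then obtain T' a where T': "T = T' @ [a]"
    by (cases T rule: rev_cases) (auto simp: fib_tilings_def)
  \<comment> \<open>Otherwise the top tile would also be the bottom one, hence of height 1, but the
    column has height at least 2. So the bottom tile survives the removal of the top tile.\<close>
  have "T' \<noteq> []"
    using T by (auto simp: fib_tilings_def T')
  then show "T \<in> (\<lambda>T. T @ [1]) ` fib_tilings (Suc m) \<union> (\<lambda>T. T @ [2]) ` fib_tilings m"
    using T by (auto simp: fib_tilings_def T')
qed (auto simp: fib_tilings_def)

lemma sum_power_lessThan_add:
  fixes q :: "'a::comm_semiring_1"
  shows "(\<Sum>i<m + n. q ^ i) = (\<Sum>i<m. q ^ i) + q ^ m * (\<Sum>i<n. q ^ i)"
  by (induction n) (simp_all add: distrib_left power_add ac_simps)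

lemma sum_tiling_rank:
  fixes q :: "'a::comm_semiring_1"
  shows "(\<Sum>T\<in>fib_tilings m. q ^ tiling_rank T) = (\<Sum>i<fib m. q ^ i)"
proof (induction m rule: fib.induct)
  case 1
  show ?case by (simp add: fib_tilings_0)
next
  case 2
  show ?case by (simp add: fib_tilings_1 tiling_rank_def domino_tops_def)
next
  case (3 m)
  have inj: "inj_on (\<lambda>T. T @ [a]) A" for a :: nat and A
    by (simp add: inj_on_def)
  have rank: "tiling_rank (T @ [2]) = fib (Suc m) + tiling_rank T" if "T \<in> fib_tilings m" for T
    using that by (simp add: tiling_rank_snoc fib_tilings_def)
  have "(\<Sum>T\<in>fib_tilings (Suc (Suc m)). q ^ tiling_rank T) =
      (\<Sum>T\<in>fib_tilings (Suc m). q ^ tiling_rank (T @ [1])) +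
      (\<Sum>T\<in>fib_tilings m. q ^ tiling_rank (T @ [2]))"
    unfolding fib_tilings_Suc_Suc
    by (subst sum.union_disjoint) (auto simp: finite_fib_tilings sum.reindex[OF inj])
  \<comment> \<open>The exponents of the domino-topped tilings fill the block of length
    \<open>fib m\<close> that starts right after the block of length \<open>fib (Suc m)\<close> of
    the other tilings.\<close>
  also have "\<dots> = (\<Sum>i<fib (Suc m). q ^ i) + q ^ fib (Suc m) * (\<Sum>i<fib m. q ^ i)"
    using 3 by (simp add: tiling_rank_snoc[of _ "Suc 0"] rank power_add flip: sum_distrib_left)
  also have "\<dots> = (\<Sum>i<fib (Suc m) + fib m. q ^ i)"
    by (simp only: sum_power_lessThan_add)
  finally show ?case by simp
qed

text \<open>This is the geometric sum in closed form; \<open>q \<noteq> 1\<close> makes the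
  denominator of \<open>qint\<close> nonzero.\<close>

lemma sum_tiling_rank_eq_qint:
  fixes q :: "'a::field"
  assumes "q \<noteq> 1"
  shows "(\<Sum>T\<in>fib_tilings m. q ^ tiling_rank T) = qint q (int (fib m))"
  using assms by (simp add: sum_tiling_rank sum_gp_strict qint_def)

text \<open>This is the coefficient of x^k in the product of the factors
  \<open>c i + a i * x\<close> over \<open>i < n\<close>.\<close>

definition subset_sum :: "nat \<Rightarrow> nat \<Rightarrow> (nat \<Rightarrow> 'a) \<Rightarrow> (nat \<Rightarrow> 'a) \<Rightarrow> 'a::comm_semiring_1" where
  "subset_sum k n a c =
     (\<Sum>I | I \<subseteq> {..<n} \<and> card I = k. (\<Prod>i\<in>I. a i) * (\<Prod>j\<in>{..<n} - I. c j))"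

lemma subset_sum_cong:
  assumes "\<And>i. i < n \<Longrightarrow> a i = a' i" and "\<And>i. i < n \<Longrightarrow> c i = c' i"
  shows "subset_sum k n a c = subset_sum k n a' c'"
  unfolding subset_sum_def
  by (intro sum.cong refl arg_cong2[where f = "(*)"] prod.cong) (use assms in auto)

text \<open>In terms of the generating polynomial, this compares coefficients after multiplication
  by one more factor \<open>c n + a n * x\<close>. The proof splits the index sets by whether they
  contain \<open>n\<close>.\<close>

lemma subset_sum_Suc_Suc:
  "subset_sum (Suc k) (Suc n) a c =
     c n * subset_sum (Suc k) n a c + a n * subset_sum k n a c"
proof -
  let ?S = "\<lambda>k. {I. I \<subseteq> {..<n} \<and> card I = k}"
  let ?w = "\<lambda>n I. (\<Prod>i\<in>I. a i) * (\<Prod>j\<in>{..<n} - I. c j)"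
  have fin: "finite I" if "I \<subseteq> {..<n}" for I
    using that finite_subset by blast
  have finS: "finite (?S k)" for k
    by (rule finite_subset[of _ "Pow {..<n}"]) auto
  have split: "{I. I \<subseteq> {..<Suc n} \<and> card I = Suc k} = ?S (Suc k) \<union> insert n ` ?S k"
  proof (intro equalityI subsetI)
    fix I assume I: "I \<in> {I. I \<subseteq> {..<Suc n} \<and> card I = Suc k}"
    show "I \<in> ?S (Suc k) \<union> insert n ` ?S k"
    proof (cases "n \<in> I")
      case True
      then have "I = insert n (I - {n})" "I - {n} \<in> ?S k"
        using I by (auto simp: less_Suc_eq)
      then show ?thesis by blast
    next
      case False
      then show ?thesis using I by (auto simp: less_Suc_eq)
    qed
  next
    fix I assume "I \<in> ?S (Suc k) \<union> insert n ` ?S k"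
    moreover have "card (insert n J) = Suc (card J)" if "J \<subseteq> {..<n}" for J
      using that fin by (subst card_insert_disjoint) auto
    ultimately show "I \<in> {I. I \<subseteq> {..<Suc n} \<and> card I = Suc k}"
      by (auto simp: less_Suc_eq)
  qed
  \<comment> \<open>No member of \<open>?S k\<close> contains \<open>n\<close>, so deleting
    \<open>n\<close> undoes the insertion.\<close>
  have inj: "inj_on (insert n) (?S k)"
    by (rule inj_onI) (metis (mono_tags, lifting) insert_ident lessThan_iff less_irrefl mem_Collect_eq subsetD)
  have old: "?w (Suc n) I = c n * ?w n I" if "I \<in> ?S (Suc k)" for I
  proof -
    have "{..<Suc n} - I = insert n ({..<n} - I)"
      using that by auto
    then show ?thesis by (simp add: ac_simps)
  qed
  have new: "?w (Suc n) (insert n I) = a n * ?w n I" if "I \<in> ?S k" for I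
  proof -
    have "{..<Suc n} - insert n I = {..<n} - I" "n \<notin> I" "finite I"
      using that fin by auto
    then show ?thesis by (simp add: ac_simps)
  qed
  have "subset_sum (Suc k) (Suc n) a c =
      (\<Sum>I\<in>?S (Suc k). ?w (Suc n) I) + (\<Sum>I\<in>?S k. ?w (Suc n) (insert n I))"
    unfolding subset_sum_def split
    by (subst sum.union_disjoint) (auto simp: finS sum.reindex[OF inj])
  also have "\<dots> = c n * subset_sum (Suc k) n a c + a n * subset_sum k n a c"
    using old new by (simp add: subset_sum_def sum_distrib_left)
  finally show ?thesis .
qed

text \<open>For a fixed column set the tilings are chosen independently, so the sum over families
  factors into a product of column sums. Leaving \<open>c\<close> arbitrary covers both
  weights.\<close>

lemma sum_fib_file_placements:
  fixes q :: "'a::comm_semiring_1"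
  shows "(\<Sum>(I, T)\<in>fib_file_placements k B.
      (\<Prod>i\<in>I. q ^ tiling_rank (T i)) * (\<Prod>j\<in>{..<length B} - I. c j)) =
    subset_sum k (length B) (\<lambda>i. \<Sum>T\<in>fib_tilings (B ! i). q ^ tiling_rank T) c"
proof -
  let ?S = "{I. I \<subseteq> {..<length B} \<and> card I = k}"
  have finS: "finite ?S"
    by (rule finite_subset[of _ "Pow {..<length B}"]) auto
  have fin: "finite I" if "I \<in> ?S" for I
    using that finite_subset[of I "{..<length B}"] by simp
  have "finite (\<Pi>\<^sub>E i\<in>I. fib_tilings (B ! i))" if "I \<in> ?S" for I
    using fin[OF that] by (simp add: finite_PiE finite_fib_tilings)
  then have "(\<Sum>(I, T)\<in>fib_file_placements k B.
      (\<Prod>i\<in>I. q ^ tiling_rank (T i)) * (\<Prod>j\<in>{..<length B} - I. c j)) =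
    (\<Sum>I\<in>?S. \<Sum>T\<in>(\<Pi>\<^sub>E i\<in>I. fib_tilings (B ! i)).
      (\<Prod>i\<in>I. q ^ tiling_rank (T i)) * (\<Prod>j\<in>{..<length B} - I. c j))"
    unfolding fib_file_placements_def by (subst sum.Sigma[OF finS]) auto
  \<comment> \<open>\<open>prod_sum_PiE\<close> expands the product of sums on the right into the
    sum over extensional families. The second product does not depend on the tilings and is pulled
    out.\<close>
  also have "\<dots> = (\<Sum>I\<in>?S. (\<Prod>i\<in>I. \<Sum>T\<in>fib_tilings (B ! i). q ^ tiling_rank T) *
      (\<Prod>j\<in>{..<length B} - I. c j))"
    by (intro sum.cong refl, subst prod_sum_PiE)
      (simp_all only: fin finite_fib_tilings sum_distrib_right)
  finally show ?thesis
    by (simp add: subset_sum_def)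
qed

lemma FT_eq_subset_sum:
  assumes "q \<noteq> 1"
  shows "FT k B q = subset_sum k (length B) (\<lambda>i. qint q (int (fib (B ! i)))) (\<lambda>i. q ^ fib (B ! i))"
  using sum_fib_file_placements[where B = B and c = "\<lambda>i. q ^ fib (B ! i)" and k = k and q = q]
  by (simp only: FT_def placement_weight_def power_add power_sum sum_tiling_rank_eq_qint[OF assms])

lemma FT_bar_eq_subset_sum:
  assumes "q \<noteq> 1"
  shows "FT_bar k B q = subset_sum k (length B) (\<lambda>i. qint q (int (fib (B ! i)))) (\<lambda>_. 1)"
  using sum_fib_file_placements[where B = B and c = "\<lambda>_. 1" and k = k and q = q]
  by (simp only: FT_bar_def placement_weight_bar_def power_sum sum_tiling_rank_eq_qint[OF assms]
      prod.neutral_const mult_1_right)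

theorem theorem3:
  fixes B :: "nat list" and k :: nat and q :: "'a::field"
  assumes "sorted B" and "B \<noteq> []" and "last B > 0"
    and "1 \<le> k" and "k \<le> length B"
    and "q \<noteq> 1"
  shows "FT k B q =
           q ^ fib (last B) * FT k (butlast B) q
           + qint q (int (fib (last B))) * FT (k - 1) (butlast B) q \<and>
         FT_bar k B q =
           FT_bar k (butlast B) q
           + qint q (int (fib (last B))) * FT_bar (k - 1) (butlast B) q"
proof -
  obtain C b where B: "B = C @ [b]"
    using assms(2) by (cases B rule: rev_cases) auto
  obtain l where k: "k = Suc l"
    using assms(4) by (cases k) auto
  \<comment> \<open>Indices below \<open>length C\<close> never reach the appended column.\<close>
  have restrict: "subset_sum j (length C) (\<lambda>i. f ((C @ [b]) ! i)) (\<lambda>i. g ((C @ [b]) ! i)) =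
      subset_sum j (length C) (\<lambda>i. f (C ! i)) (\<lambda>i. g (C ! i))" for j and f g :: "nat \<Rightarrow> 'a"
    by (rule subset_sum_cong) (auto simp: nth_append)
  \<comment> \<open>Here \<open>f\<close> and \<open>g\<close> are weights of a chosen and an
    unchosen column as functions of its height. Taking \<open>g\<close> as the power of
    \<open>q\<close> or as the constant 1 gives the two recurrences.\<close>
  have split: "subset_sum (Suc l) (length (C @ [b])) (\<lambda>i. f ((C @ [b]) ! i)) (\<lambda>i. g ((C @ [b]) ! i)) =
      g b * subset_sum (Suc l) (length C) (\<lambda>i. f (C ! i)) (\<lambda>i. g (C ! i)) +
      f b * subset_sum l (length C) (\<lambda>i. f (C ! i)) (\<lambda>i. g (C ! i))" for f g :: "nat \<Rightarrow> 'a"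
    by (simp add: subset_sum_Suc_Suc restrict[of _ f g])
  show ?thesis
    using split[of "\<lambda>m. qint q (int (fib m))" "\<lambda>m. q ^ fib m"]
      split[of "\<lambda>m. qint q (int (fib m))" "\<lambda>_. 1"]
    by (simp add: B k FT_eq_subset_sum[OF assms(6)] FT_bar_eq_subset_sum[OF assms(6)])
qed

end
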